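(* There exists a constant $c>0$ such that for all sufficiently large $n\in\mathbb{N}$, at least $n^{c/\log\log n}$ distinct distances each occur at least $n^{1+c/\log\log n}$ times in the $\sqrt{n}\times\sqrt{n}$ grid.
   Context: The $\sqrt n\times\sqrt n$ grid is the point set $\{1,\dots,\lfloor\sqrt n\rfloor\}^2\subseteq\mathbb{R}^2$ (exactly $n$ points when $n$ is a perfect square). A distance $d>0$ occurs $t$ times in a finite point set $X\subseteq\mathbb{R}^2$ if there are exactly $t$ unordered pairs of distinct points of $X$ at Euclidean distance $d$. *)

theory Defs
  imports "HOL-Analysis.Analysis"
begin

definition sqrt_grid :: "nat \<Rightarrow> (real ^ 2) set" where
  "sqrt_grid n = {p. \<forall>i. \<exists>k \<in> {1..nat \<lfloor>sqrt (real n)\<rfloor>}. p $ i = real k}"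

text \<open>Pairs are unordered: the elements counted are two-element sets, so every pair
  of points contributes once. Only meant for finite \<open>X\<close> and \<open>d > 0\<close>.\<close>

definition occurrences :: "(real ^ 2) set \<Rightarrow> real \<Rightarrow> nat" where
  "occurrences X d = card {{p, q} | p q. p \<in> X \<and> q \<in> X \<and> p \<noteq> q \<and> dist p q = d}"

end

(*
  It suffices to find one m <= n^(1/8) with n^(c/log log n) representations as u^2 + v^2: each
  displacement (u, v) occurs at a positive proportion of the grid points, and the distances
  j sqrt m for j <= n^(1/16) inherit the representations.

  A product of k distinct odd primes, each a sum of two squares, has at least 2^k representations,
  so many small prime divisors of values a^2 + 1 are needed. Let M be the lcm of a^2 + 1 for
  T <= a <= 2T and x = T + i. By partial fractions M T! / (x (x + 1) ... (x + T)) is a nonzero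
  Gaussian integer, so it has norm at least 1, and |x + a| >= T + a gives M >= 2^T. Every prime power in M is at
  most 4T^2 + 1, hence M has at least T log 2 / log (4T^2 + 1) prime divisors. Take T ~ log n / 8.
*)

theory Submission
  imports Defs "HOL-Computational_Algebra.Primes" "HOL-Library.Discrete_Functions"
    "HOL-Real_Asymp.Real_Asymp"
begin

section \<open>Gaussian integers and rising factorials\<close>

text \<open>A subset of \<open>complex\<close> rather than a separate type, so that quotients and
  norms are those of the field.\<close>

definition gaussian_ints :: "complex set" where
  "gaussian_ints = {z. Re z \<in> \<int> \<and> Im z \<in> \<int>}"

lemma gaussian_ints_diff:
  "z \<in> gaussian_ints \<Longrightarrow> w \<in> gaussian_ints \<Longrightarrow> z - w \<in> gaussian_ints"
  by (simp add: gaussian_ints_def)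

lemma norm_gaussian_int_ge_1:
  assumes "z \<in> gaussian_ints" "z \<noteq> 0"
  shows "1 \<le> norm z"
proof (cases "Re z = 0")
  case True
  then have "1 \<le> \<bar>Im z\<bar>"
    using assms by (auto simp: gaussian_ints_def complex_eq_iff intro: Ints_nonzero_abs_ge1)
  then show ?thesis using abs_Im_le_cmod[of z] by linarith
next
  case False
  then have "1 \<le> \<bar>Re z\<bar>"
    using assms by (auto simp: gaussian_ints_def intro: Ints_nonzero_abs_ge1)
  then show ?thesis using abs_Re_le_cmod[of z] by linarith
qed

text \<open>The induction step is \<open>1/x - 1/(x + n + 1) = (n + 1)/(x (x + n + 1))\<close>, multiplied by the
  common factors.\<close>

lemma fact_div_pochhammer_gaussian:
  fixes x c :: complex
  assumes "\<And>a. a \<le> n \<Longrightarrow> x + of_nat a \<noteq> 0"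
    and "\<And>a. a \<le> n \<Longrightarrow> c / (x + of_nat a) \<in> gaussian_ints"
  shows "c * fact n / pochhammer x (Suc n) \<in> gaussian_ints"
  using assms
proof (induction n arbitrary: x)
  case 0
  from 0(2)[of 0] show ?case by simp
next
  case (Suc n)
  define q where "q = pochhammer (x + 1) n"
  have x0: "x \<noteq> 0" using Suc.prems(1)[of 0] by simp
  have y0: "x + 1 + of_nat n \<noteq> 0" using Suc.prems(1)[of "Suc n"] by (simp add: algebra_simps)
  have q0: "q \<noteq> 0"
  proof
    assume "q = 0"
    then obtain k where "k < n" "x + 1 = - of_nat k"
      by (auto simp: q_def pochhammer_eq_0_iff)
    then have "x + of_nat (Suc k) = 0" by (simp add: add.assoc[symmetric])
    then show False using Suc.prems(1)[of "Suc k"] \<open>k < n\<close> by simp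
  qed
  have 1: "c * fact n / pochhammer x (Suc n) \<in> gaussian_ints"
    using Suc.prems by (intro Suc.IH) auto
  have 2: "c * fact n / pochhammer (x + 1) (Suc n) \<in> gaussian_ints"
  proof (rule Suc.IH)
    fix a assume "a \<le> n"
    then show "x + 1 + of_nat a \<noteq> 0" "c / (x + 1 + of_nat a) \<in> gaussian_ints"
      using Suc.prems[of "Suc a"] by (simp_all add: algebra_simps)
  qed
  have p1: "pochhammer x (Suc n) = x * q" by (simp add: pochhammer_rec q_def)
  have p2: "pochhammer (x + 1) (Suc n) = q * (x + 1 + of_nat n)" 
    by (simp add: pochhammer_Suc q_def)
  have p3: "pochhammer x (Suc (Suc n)) = x * (q * (x + 1 + of_nat n))"
    by (simp only: pochhammer_rec[of x "Suc n"] p2)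
  have "c * fact n / (x * q) - c * fact n / (q * (x + 1 + of_nat n))
      = c * fact (Suc n) / (x * (q * (x + 1 + of_nat n)))"
    using x0 y0 q0 by (simp add: divide_simps) (simp add: algebra_simps)
  then show ?case
    using gaussian_ints_diff[OF 1 2] by (simp only: p1 p2 p3)
qed

lemma norm_pochhammer_ge:
  fixes x :: complex
  assumes "Re x \<ge> 0"
  shows "pochhammer (Re x) n \<le> norm (pochhammer x n)"
proof -
  have "(\<Prod>i<n. Re x + real i) \<le> (\<Prod>i<n. norm (x + of_nat i))"
  proof (intro prod_mono conjI)
    fix i
    show "0 \<le> Re x + real i" using assms by simp
    show "Re x + real i \<le> norm (x + of_nat i)" using complex_Re_le_cmod[of "x + of_nat i"] by simp
  qed
  then show ?thesis by (simp add: pochhammer_prod prod_norm atLeast0LessThan)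
qed

text \<open>Factor by factor: n + 1 + i \<ge> 2 (i + 1) whenever i < n.\<close>

lemma two_power_fact_le_pochhammer: "2 ^ n * fact n \<le> pochhammer (real n + 1) n"
proof -
  have "2 ^ n * fact n = (\<Prod>i<n. 2 * (real i + 1))"
    by (simp only: prod.distrib fact_prod_Suc) (simp add: atLeast0LessThan add.commute)
  also have "\<dots> \<le> (\<Prod>i<n. real n + 1 + real i)"
    by (intro prod_mono) auto
  finally show ?thesis by (simp add: pochhammer_prod atLeast0LessThan)
qed

section \<open>Prime factors of a least common multiple\<close>

text \<open>The multiplicity of \<open>p\<close> in an lcm is the maximum of the multiplicities, so
  a single element attains it. In the empty case the lcm is 1, which \<open>e > 0\<close>
  excludes.\<close>

lemma prime_power_dvd_Lcm:
  fixes A :: "nat set"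
  assumes "finite A" "0 \<notin> A" "prime p" "e > 0" "p ^ e dvd Lcm A"
  shows "\<exists>a\<in>A. p ^ e dvd a"
  using assms(1,2,5)
proof (induction A)
  case empty
  then show ?case using assms(3,4) by auto
next
  case (insert a A)
  have "Lcm A \<noteq> 0" using insert by (simp add: Lcm_0_iff)
  moreover have "a \<noteq> 0" using insert.prems by auto
  ultimately have "multiplicity p (lcm a (Lcm A)) = max (multiplicity p a) (multiplicity p (Lcm A))"
    by (intro multiplicity_lcm) (use \<open>prime p\<close> in auto)
  moreover have "p ^ k dvd x \<longleftrightarrow> k \<le> multiplicity p x" if "x \<noteq> 0" for k x
    using that not_prime_unit[of p] \<open>prime p\<close> by (intro power_dvd_iff_le_multiplicity) auto
  moreover have "p ^ e dvd lcm a (Lcm A)" using insert.prems by simp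
  ultimately have "p ^ e dvd a \<or> p ^ e dvd Lcm A"
    using \<open>Lcm A \<noteq> 0\<close> \<open>a \<noteq> 0\<close> by (metis lcm_eq_0_iff le_max_iff_disj)
  then show ?case using insert by auto
qed

text \<open>Each full prime power in the lcm already divides one element of \<open>A\<close> and is
  therefore at most \<open>q\<close>. A large lcm of small numbers thus forces many distinct
  primes.\<close>

lemma Lcm_le_power_card_prime_factors:
  fixes A :: "nat set"
  assumes "finite A" "0 \<notin> A" and le: "\<And>a. a \<in> A \<Longrightarrow> a \<le> q"
  shows "Lcm A \<le> q ^ card (prime_factors (Lcm A))"
proof -
  have "Lcm A \<noteq> 0" using assms by (simp add: Lcm_0_iff)
  then have "Lcm A = (\<Prod>p\<in>prime_factors (Lcm A). p ^ multiplicity p (Lcm A))"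
    by (simp add: prod_prime_factors)
  also have "\<dots> \<le> (\<Prod>p\<in>prime_factors (Lcm A). q)"
  proof (intro prod_mono conjI)
    fix p assume p: "p \<in> prime_factors (Lcm A)"
    then have "multiplicity p (Lcm A) > 0" by (simp add: prime_factors_multiplicity)
    then obtain a where "a \<in> A" "p ^ multiplicity p (Lcm A) dvd a"
      using prime_power_dvd_Lcm[OF assms(1,2), of p] p multiplicity_dvd[of p "Lcm A"] by blast
    then show "p ^ multiplicity p (Lcm A) \<le> q"
      using le[of a] dvd_imp_le[of _ a] assms(2) by fastforce
  qed simp
  finally show ?thesis by simp
qed

section \<open>Representations as a sum of two squares\<close>

text \<open>Thue's argument: more than \<open>p\<close> pairs (x, y) with entries in 0..s share the
  \<open>p\<close> residues of x - c y. The difference (u, v) of two colliding pairs makes u^2 + v^2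
  a multiple of \<open>p\<close> strictly between 0 and 2 p.\<close>

lemma prime_dvd_square_plus_1_imp_sum_squares:
  fixes p :: nat and c :: int
  assumes p: "prime p" and dvd: "int p dvd c\<^sup>2 + 1"
  shows "\<exists>u v::int. u\<^sup>2 + v\<^sup>2 = int p"
proof -
  define s where "s = floor_sqrt p"
  have s1: "s\<^sup>2 \<le> p" and s2: "p < (Suc s)\<^sup>2"
    by (simp_all add: s_def Suc_floor_sqrt_power2_gt)
  \<comment> \<open>A prime is not a square. The strict inequality s^2 < p is what gives u^2 + v^2 <
    2 p below.\<close>
  have "s\<^sup>2 \<noteq> p" using p prime_power_iff[of s 2] by auto
  then have s3: "s\<^sup>2 < p" using s1 by simp
  define A where "A = {0..int s} \<times> {0..int s}"
  define f where "f = (\<lambda>(x, y). (x - c * y) mod int p)"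
  have p0: "p > 0" using p prime_gt_0_nat by blast
  have "f ` A \<subseteq> {0..<int p}" using p0 by (auto simp: f_def)
  then have "card (f ` A) \<le> p" using card_mono[of "{0..<int p}" "f ` A"] by simp
  also have "\<dots> < card A"
  proof -
    have "nat (int s + 1) = Suc s" by simp
    then show ?thesis using s2 by (simp add: A_def card_cartesian_product power2_eq_square)
  qed
  finally have "\<not> inj_on f A" by (rule pigeonhole)
  then obtain x y x' y' where xy: "(x, y) \<in> A" "(x', y') \<in> A" "(x, y) \<noteq> (x', y')"
    "f (x, y) = f (x', y')" by (auto simp: inj_on_def)
  define u v where "u = x - x'" and "v = y - y'"
  have "int p dvd (x - c * y) - (x' - c * y')" using xy(4) by (simp add: f_def mod_eq_dvd_iff)
  then have 1: "int p dvd u - c * v" by (simp add: u_def v_def algebra_simps)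
  \<comment> \<open>Modulo \<open>p\<close>, u is c v and c^2 is -1, so u^2 + v^2 vanishes.\<close>
  have "u\<^sup>2 + v\<^sup>2 = (u - c * v) * (u + c * v) + (c\<^sup>2 + 1) * v\<^sup>2"
    by (simp add: power2_eq_square algebra_simps)
  then have 2: "int p dvd u\<^sup>2 + v\<^sup>2" using 1 dvd by simp
  have "\<bar>u\<bar> \<le> int s" "\<bar>v\<bar> \<le> int s" using xy(1,2) by (auto simp: A_def u_def v_def)
  then have "u\<^sup>2 \<le> (int s)\<^sup>2" "v\<^sup>2 \<le> (int s)\<^sup>2" by (simp_all add: abs_le_square_iff[symmetric])
  moreover have "(int s)\<^sup>2 < int p" using s3 by (metis of_nat_less_iff of_nat_power)
  ultimately have 3: "u\<^sup>2 + v\<^sup>2 < 2 * int p" by linarith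
  have 4: "u\<^sup>2 + v\<^sup>2 > 0" using xy(3) by (auto simp: u_def v_def sum_power2_gt_zero_iff)
  from 2 obtain k where k: "u\<^sup>2 + v\<^sup>2 = int p * k" by (elim dvdE)
  have "k > 0" using 4 k p0 by (simp add: zero_less_mult_iff)
  moreover have "k < 2" using 3 k p0 by (simp add: mult.commute)
  ultimately have "k = 1" by simp
  then show ?thesis using k by auto
qed

text \<open>Signs and order count, so the cardinality is the classical r_2(m). Each element is a
  displacement of length sqrt m.\<close>

definition square_reps :: "nat \<Rightarrow> (int \<times> int) set" where
  "square_reps m = {(u, v). u\<^sup>2 + v\<^sup>2 = int m}"

lemma square_reps_bound:
  assumes "(u, v) \<in> square_reps m" "m \<le> h\<^sup>2"
  shows "\<bar>u\<bar> \<le> int h" "\<bar>v\<bar> \<le> int h"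
proof -
  have "int m \<le> (int h)\<^sup>2" using assms(2) by (metis of_nat_le_iff of_nat_power)
  then have "u\<^sup>2 \<le> (int h)\<^sup>2" "v\<^sup>2 \<le> (int h)\<^sup>2"
    using assms(1) zero_le_power2[of u] zero_le_power2[of v]
    unfolding square_reps_def mem_Collect_eq prod.case by linarith+
  then show "\<bar>u\<bar> \<le> int h" "\<bar>v\<bar> \<le> int h" by (simp_all add: abs_le_square_iff[symmetric])
qed

lemma finite_square_reps: "finite (square_reps m)"
proof (rule finite_subset)
  have "m \<le> m\<^sup>2" by (simp add: power2_eq_square)
  then show "square_reps m \<subseteq> {- int m..int m} \<times> {- int m..int m}"
    using square_reps_bound[of _ _ m m] by fastforce
qed simp

text \<open>Write z = u + v i and pi = a + b i, a Gaussian integer of norm \<open>p\<close>.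
  Multiplication of z by pi (the map \<open>f\<close>) and by its conjugate (the map
  \<open>g\<close>) gives two injections into the representations of p m. Their images are disjoint,
  since a common value would make \<open>p\<close> divide 2 a b m.\<close>

lemma card_square_reps_prime_mult:
  fixes p m :: nat
  assumes p: "prime p" "p \<noteq> 2" "\<not> p dvd m" and ab: "a\<^sup>2 + b\<^sup>2 = int p"
  shows "2 * card (square_reps m) \<le> card (square_reps (p * m))"
proof -
  let ?R = "square_reps m"
  define f where "f = (\<lambda>(u, v). (u * a - v * b, u * b + v * a))"
  define g where "g = (\<lambda>(u, v). (u * a + v * b, v * a - u * b))"
  have p0: "int p > 0" using p prime_gt_0_nat by auto
  have pp: "prime (int p)" using p by simp
  have not_dvd: "\<not> int p dvd 2 * a * b * int m"
  proof
    assume "int p dvd 2 * a * b * int m"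
    then have "int p dvd 2 \<or> int p dvd a \<or> int p dvd b \<or> int p dvd int m"
      using pp by (simp add: prime_dvd_mult_iff)
    moreover have "\<not> int p dvd int m" using p by simp
    moreover have "\<not> int p dvd 2" using p primes_dvd_imp_eq[of p 2] by (metis int_dvd_int_iff of_nat_numeral two_is_prime_nat)
    ultimately have "int p dvd a \<or> int p dvd b" by simp
    \<comment> \<open>If \<open>p\<close> divides one of a, b, it divides the other as well, and
      then p^2 divides a^2 + b^2 = p.\<close>
    then have "int p dvd a \<and> int p dvd b"
    proof
      assume *: "int p dvd a"
      have "b\<^sup>2 = int p - a * a" using ab by (simp add: power2_eq_square)
      then have "int p dvd b\<^sup>2" using * by simp
      then show ?thesis using * pp by (simp add: prime_dvd_power_iff)
    next
      assume *: "int p dvd b"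
      have "a\<^sup>2 = int p - b * b" using ab by (simp add: power2_eq_square)
      then have "int p dvd a\<^sup>2" using * by simp
      then show ?thesis using * pp by (simp add: prime_dvd_power_iff)
    qed
    then have "(int p)\<^sup>2 dvd a\<^sup>2 + b\<^sup>2" by (intro dvd_add) (simp_all add: dvd_power_same)
    then have "int p * int p dvd int p * 1" using ab by (simp add: power2_eq_square)
    then have "int p dvd 1" using p0 by (subst (asm) dvd_times_left_cancel_iff) auto
    then show False using pp not_prime_unit by blast
  qed
  have inj_f: "inj_on f ?R"
  proof (rule inj_on_inverseI)
    \<comment> \<open>The inverse multiplies by the conjugate of pi and divides by the norm
      \<open>p\<close>; for \<open>g\<close> the roles of pi and its conjugate are
      exchanged.\<close>
    fix z show "(\<lambda>(X, Y). ((X * a + Y * b) div int p, (Y * a - X * b) div int p)) (f z) = z"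
    proof (cases z)
      case (Pair u v)
      have "(u * a - v * b) * a + (u * b + v * a) * b = u * (a\<^sup>2 + b\<^sup>2)"
        "(u * b + v * a) * a - (u * a - v * b) * b = v * (a\<^sup>2 + b\<^sup>2)"
        by (simp_all add: power2_eq_square algebra_simps)
      then show ?thesis using p0 Pair by (simp add: f_def ab)
    qed
  qed
  have inj_g: "inj_on g ?R"
  proof (rule inj_on_inverseI)
    fix z show "(\<lambda>(X, Y). ((X * a - Y * b) div int p, (X * b + Y * a) div int p)) (g z) = z"
    proof (cases z)
      case (Pair u v)
      have "(u * a + v * b) * a - (v * a - u * b) * b = u * (a\<^sup>2 + b\<^sup>2)"
        "(u * a + v * b) * b + (v * a - u * b) * a = v * (a\<^sup>2 + b\<^sup>2)"
        by (simp_all add: power2_eq_square algebra_simps)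
      then show ?thesis using p0 Pair by (simp add: g_def ab)
    qed
  qed
  have sub: "f ` ?R \<subseteq> square_reps (p * m)" "g ` ?R \<subseteq> square_reps (p * m)"
  proof -
    have "(u * a - v * b)\<^sup>2 + (u * b + v * a)\<^sup>2 = (a\<^sup>2 + b\<^sup>2) * (u\<^sup>2 + v\<^sup>2)"
      "(u * a + v * b)\<^sup>2 + (v * a - u * b)\<^sup>2 = (a\<^sup>2 + b\<^sup>2) * (u\<^sup>2 + v\<^sup>2)" for u v
      by (simp_all add: power2_eq_square algebra_simps)
    then show "f ` ?R \<subseteq> square_reps (p * m)" "g ` ?R \<subseteq> square_reps (p * m)"
      by (auto simp: square_reps_def f_def g_def ab)
  qed
  have disj: "f ` ?R \<inter> g ` ?R = {}"
  proof (rule ccontr)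
    assume "f ` ?R \<inter> g ` ?R \<noteq> {}"
    then obtain u v u' v' where uv: "(u, v) \<in> ?R" "f (u, v) = g (u', v')"
      by (metis (no_types, opaque_lifting) disjoint_iff imageE surj_pair)
    then have 1: "u * a - v * b = u' * a + v' * b" "u * b + v * a = v' * a - u' * b"
      by (simp_all add: f_def g_def)
    \<comment> \<open>A collision says z pi = z' conj(pi). Multiplied by pi conj(z) it becomes |z|^2
      pi^2 = p z' conj(z); the identity is the imaginary part of this.\<close>
    have "2 * a * b * (u\<^sup>2 + v\<^sup>2)
        = u * (b * (u * a - v * b) + a * (u * b + v * a))
          - v * (a * (u * a - v * b) - b * (u * b + v * a))"
      by (simp add: power2_eq_square algebra_simps)
    also have "\<dots> = (a\<^sup>2 + b\<^sup>2) * (u * v' - v * u')"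
      unfolding 1 by (simp add: power2_eq_square algebra_simps)
    finally have "2 * a * b * (u\<^sup>2 + v\<^sup>2) = (a\<^sup>2 + b\<^sup>2) * (u * v' - v * u')" .
    then have "2 * a * b * int m = int p * (u * v' - v * u')"
      using uv(1) by (simp add: ab square_reps_def)
    then show False using not_dvd by simp
  qed
  have "2 * card ?R = card (f ` ?R) + card (g ` ?R)"
    by (simp add: card_image inj_f inj_g)
  also have "\<dots> = card (f ` ?R \<union> g ` ?R)"
    by (intro card_Un_disjoint [symmetric] finite_imageI finite_square_reps disj)
  also have "\<dots> \<le> card (square_reps (p * m))"
    using sub by (intro card_mono finite_square_reps) auto
  finally show ?thesis .
qed

text \<open>Every new prime at least doubles the count, starting from the representation (1, 0) of
  1.\<close>

lemma card_square_reps_prod_primes: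
  assumes "finite Q" and "\<And>p. p \<in> Q \<Longrightarrow> prime p \<and> p \<noteq> 2 \<and> (\<exists>u v. u\<^sup>2 + v\<^sup>2 = int p)"
  shows "2 ^ card Q \<le> card (square_reps (\<Prod>Q))"
  using assms
proof (induction Q)
  case empty
  have "{(1, 0)} \<subseteq> square_reps 1" by (simp add: square_reps_def)
  then show ?case using card_mono[OF finite_square_reps, of "{(1, 0)}" 1] by simp
next
  case (insert p Q)
  have p: "prime p" "p \<noteq> 2" and "\<exists>u v. u\<^sup>2 + v\<^sup>2 = int p" using insert.prems by auto
  then obtain a b where ab: "a\<^sup>2 + b\<^sup>2 = int p" by blast
  have "\<not> p dvd \<Prod>Q"
  proof
    assume "p dvd \<Prod>Q"
    then obtain q where "q \<in> Q" "p dvd q"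
      using prime_dvd_prod_iff[OF \<open>finite Q\<close> \<open>prime p\<close>, of "\<lambda>x. x"] by auto
    then have "p = q" using primes_dvd_imp_eq p(1) insert.prems by blast
    then show False using \<open>q \<in> Q\<close> insert.hyps by simp
  qed
  from card_square_reps_prime_mult[OF p this ab] show ?case
    using insert by simp
qed

section \<open>Small numbers with many representations\<close>

lemma two_power_le_Lcm:
  assumes "T > 0"
  shows "2 ^ T \<le> Lcm ((\<lambda>a::nat. a\<^sup>2 + 1) ` {T..2 * T})"
proof -
  define M where "M = Lcm ((\<lambda>a::nat. a\<^sup>2 + 1) ` {T..2 * T})"
  define x where "x = Complex (real T) 1"
  have M0: "M \<noteq> 0" by (auto simp: M_def Lcm_0_iff)
  have x0: "x + of_nat a \<noteq> 0" for a by (simp add: x_def complex_eq_iff)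
  have "of_nat M * fact T / pochhammer x (Suc T) \<in> gaussian_ints"
  proof (rule fact_div_pochhammer_gaussian)
    fix a assume "a \<le> T"
    then have "(T + a)\<^sup>2 + 1 dvd M" unfolding M_def by (intro dvd_Lcm) auto
    then obtain k where k: "M = ((T + a)\<^sup>2 + 1) * k" by (elim dvdE)
    \<comment> \<open>(T + a)^2 + 1 is the norm of x + a = T + a + i, so the conjugate T + a - i
      supplies the cofactor.\<close>
    have "of_nat M = (x + of_nat a) * (of_nat k * Complex (real (T + a)) (- 1))"
      by (simp add: k x_def complex_eq_iff power2_eq_square algebra_simps)
    then have "of_nat M / (x + of_nat a) = of_nat k * Complex (real (T + a)) (- 1)"
      using x0[of a] by simp
    then show "of_nat M / (x + of_nat a) \<in> gaussian_ints"
      by (simp add: gaussian_ints_def)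
  qed (rule x0)
  moreover have poch0: "pochhammer x (Suc T) \<noteq> 0"
    using x0 by (auto simp: pochhammer_eq_0_iff add_eq_0_iff2)
  ultimately have "1 \<le> norm (of_nat M * fact T / pochhammer x (Suc T))"
    using M0 by (intro norm_gaussian_int_ge_1) auto
  then have "norm (pochhammer x (Suc T)) \<le> real M * fact T"
    using poch0 by (simp add: norm_divide norm_mult divide_simps split: if_splits)
  moreover have "pochhammer (real T) (Suc T) \<le> norm (pochhammer x (Suc T))"
    using norm_pochhammer_ge[of x "Suc T"] by (simp add: x_def)
  moreover have "2 ^ T * fact T \<le> pochhammer (real T) (Suc T)"
  proof -
    \<comment> \<open>The rising factorial of length T + 1 has first factor \<open>real T\<close>,
      which is at least 1 and is dropped.\<close>
    have "1 * (2 ^ T * fact T) \<le> real T * pochhammer (real T + 1) T"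
      using assms two_power_fact_le_pochhammer[of T] by (intro mult_mono) auto
    then show ?thesis by (simp add: pochhammer_rec)
  qed
  ultimately have "2 ^ T * fact T \<le> real M * fact T" by linarith
  then have "2 ^ T \<le> real M" by simp
  then show ?thesis unfolding M_def[symmetric] by (metis of_nat_le_iff of_nat_numeral of_nat_power)
qed

text \<open>With q = 4 T^2 + 1, the chain q^K \<le> 2^T \<le> Lcm \<le> q^(number of primes) yields
  at least \<open>K\<close> primes dividing values b^2 + 1. The witness is a product of K - 1 odd
  ones among them.\<close>

lemma exists_many_square_reps:
  assumes "T > 0" "(4 * T\<^sup>2 + 1) ^ K \<le> 2 ^ T"
  shows "\<exists>m>0. m \<le> 2 ^ T \<and> 2 ^ (K - 1) \<le> card (square_reps m)"
proof -
  define q where "q = 4 * T\<^sup>2 + 1"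
  define A where "A = (\<lambda>a::nat. a\<^sup>2 + 1) ` {T..2 * T}"
  have A: "finite A" "0 \<notin> A" by (auto simp: A_def)
  have Aq: "a \<le> q" if "a \<in> A" for a
  proof -
    from that obtain b where "a = b\<^sup>2 + 1" "b \<le> 2 * T" by (auto simp: A_def)
    then show ?thesis using power_mono[of b "2 * T" 2] by (simp add: q_def power_mult_distrib)
  qed
  have q1: "q > 1" using assms(1) by (simp add: q_def)
  have "q ^ K \<le> 2 ^ T" using assms(2) by (simp add: q_def)
  also have "\<dots> \<le> Lcm A" unfolding A_def by (rule two_power_le_Lcm[OF assms(1)])
  also have "\<dots> \<le> q ^ card (prime_factors (Lcm A))"
    using A Aq by (rule Lcm_le_power_card_prime_factors)
  finally have "K \<le> card (prime_factors (Lcm A))" using q1 by simp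
  \<comment> \<open>Doubling needs an odd prime; leaving out 2 costs at most one prime.\<close>
  then have "K - 1 \<le> card (prime_factors (Lcm A) - {2})"
    using card_Diff_singleton_if[of "prime_factors (Lcm A)" 2] by (simp split: if_splits)
  then obtain Q where Q: "Q \<subseteq> prime_factors (Lcm A) - {2}" "card Q = K - 1" "finite Q"
    by (rule obtain_subset_with_card_n)
  have *: "prime p \<and> p \<noteq> 2 \<and> p \<le> q \<and> (\<exists>u v. u\<^sup>2 + v\<^sup>2 = int p)" if "p \<in> Q" for p
  proof -
    have p: "prime p" "p \<noteq> 2" "p dvd Lcm A" using that Q(1) by auto
    then obtain a where a: "a \<in> A" "p dvd a"
      using prime_power_dvd_Lcm[OF A p(1), of 1] by auto
    then obtain b where b: "a = b\<^sup>2 + 1" by (auto simp: A_def)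
    have "int p dvd (int b)\<^sup>2 + 1" using a b by (metis int_dvd_int_iff of_nat_1 of_nat_add of_nat_power)
    moreover have "p \<le> q" using dvd_imp_le[OF a(2)] Aq[OF a(1)] b by simp
    ultimately show ?thesis using p prime_dvd_square_plus_1_imp_sum_squares by blast
  qed
  \<comment> \<open>The hypothesis on \<open>K\<close> serves a second time: it also keeps the
    product below 2^T.\<close>
  have "\<Prod>Q \<le> (\<Prod>p\<in>Q. q)" using * by (intro prod_mono) auto
  also have "\<dots> = q ^ (K - 1)" using Q(2) by simp
  also have "\<dots> \<le> q ^ K" using q1 by (intro power_increasing) auto
  also have "\<dots> \<le> 2 ^ T" using assms(2) by (simp add: q_def)
  finally have "\<Prod>Q \<le> 2 ^ T" .
  moreover have "\<Prod>Q > 0" using * prime_gt_0_nat by (intro prod_pos) auto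
  moreover have "2 ^ (K - 1) \<le> card (square_reps (\<Prod>Q))"
    using card_square_reps_prod_primes[OF Q(3)] * Q(2) by metis
  ultimately show ?thesis by blast
qed

text \<open>Scaling by \<open>j\<close> is injective on representations; this turns one frequent
  distance sqrt m into the family j sqrt m.\<close>

lemma card_square_reps_square_mult:
  assumes "j > 0"
  shows "card (square_reps m) \<le> card (square_reps (j\<^sup>2 * m))"
proof (rule card_inj_on_le)
  show "inj_on (\<lambda>(u, v). (int j * u, int j * v)) (square_reps m)"
    using assms by (auto simp: inj_on_def)
  show "(\<lambda>(u, v). (int j * u, int j * v)) ` square_reps m \<subseteq> square_reps (j\<^sup>2 * m)"
    by (auto simp: square_reps_def power_mult_distrib distrib_left[symmetric])
qed (rule finite_square_reps)

section \<open>Counting distances in the grid\<close>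

text \<open>Forgetting the order of a pair is at most two-to-one. Displacements count ordered pairs,
  \<open>occurrences\<close> unordered ones.\<close>

lemma card_le_twice_card_unordered_pairs:
  assumes "finite P"
  shows "card P \<le> 2 * card ((\<lambda>(p, q). {p, q}) ` P)"
proof -
  let ?h = "\<lambda>(p, q). {p, q}"
  have "card P \<le> card (\<Union>e\<in>?h ` P. {z \<in> P. ?h z = e})"
    using assms by (intro card_mono) auto
  also have "\<dots> \<le> (\<Sum>e\<in>?h ` P. card {z \<in> P. ?h z = e})"
    using assms by (intro card_UN_le) simp
  also have "\<dots> \<le> of_nat (card (?h ` P)) * 2"
  proof (rule sum_bounded_above)
    fix e assume "e \<in> ?h ` P"
    then obtain a b where "e = {a, b}" by auto
    then have "z = (a, b) \<or> z = (b, a)" if "?h z = e" for z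
      using that by (cases z) (simp add: doubleton_eq_iff)
    then have "{z \<in> P. ?h z = e} \<subseteq> {(a, b), (b, a)}" by blast
    then have "card {z \<in> P. ?h z = e} \<le> card {(a, b), (b, a)}" by (intro card_mono) auto
    also have "\<dots> \<le> 2" using card_length[of "[(a, b), (b, a)]"] by simp
    finally show "card {z \<in> P. ?h z = e} \<le> 2" .
  qed
  finally show ?thesis by simp
qed

text \<open>Integer coordinates, so that displacements with negative entries can be added.\<close>

definition int_point :: "int \<times> int \<Rightarrow> real ^ 2" where
  "int_point z = vector [of_int (fst z), of_int (snd z)]"

lemma int_point_eq_iff: "int_point z = int_point w \<longleftrightarrow> z = w"
  by (simp add: int_point_def vec_eq_iff forall_2 prod_eq_iff)

lemma dist_int_point:
  "dist (int_point (x, y)) (int_point (x + u, y + v)) = sqrt (of_int (u\<^sup>2 + v\<^sup>2))"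
  by (simp add: int_point_def dist_norm norm_eq_sqrt_inner inner_vec_def sum_2 power2_eq_square)

lemma sqrt_grid_eq:
  "sqrt_grid n = int_point ` ({1..\<lfloor>sqrt (real n)\<rfloor>} \<times> {1..\<lfloor>sqrt (real n)\<rfloor>})"
proof (intro equalityI subsetI)
  fix p assume "p \<in> sqrt_grid n"
  then obtain k l where "k \<in> {1..nat \<lfloor>sqrt (real n)\<rfloor>}" "p $ 1 = real k"
    "l \<in> {1..nat \<lfloor>sqrt (real n)\<rfloor>}" "p $ 2 = real l" unfolding sqrt_grid_def by blast
  then show "p \<in> int_point ` ({1..\<lfloor>sqrt (real n)\<rfloor>} \<times> {1..\<lfloor>sqrt (real n)\<rfloor>})"
    by (intro image_eqI[of _ _ "(int k, int l)"])
      (auto simp: int_point_def vec_eq_iff forall_2)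
next
  fix p assume "p \<in> int_point ` ({1..\<lfloor>sqrt (real n)\<rfloor>} \<times> {1..\<lfloor>sqrt (real n)\<rfloor>})"
  then obtain x y where "p = int_point (x, y)" "x \<in> {1..\<lfloor>sqrt (real n)\<rfloor>}"
    "y \<in> {1..\<lfloor>sqrt (real n)\<rfloor>}" by auto
  then have "real (nat x) = p $ 1" "nat x \<in> {1..nat \<lfloor>sqrt (real n)\<rfloor>}"
    "real (nat y) = p $ 2" "nat y \<in> {1..nat \<lfloor>sqrt (real n)\<rfloor>}"
    by (auto simp: int_point_def nat_mono)
  then show "p \<in> sqrt_grid n"
    unfolding sqrt_grid_def mem_Collect_eq forall_2 by metis
qed

lemma finite_sqrt_grid: "finite (sqrt_grid n)"
  by (simp add: sqrt_grid_eq)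

text \<open>A displacement of length sqrt m has entries of absolute value at most \<open>h\<close>,
  so it keeps every point of the central square, at margin \<open>h\<close> from the border, inside
  the grid. If 2 h exceeds the side, the truncated difference is 0 and the bound is trivial.\<close>

lemma occurrences_ge:
  assumes "0 < m" "m \<le> h\<^sup>2"
  shows "card (square_reps m) * (nat \<lfloor>sqrt (real n)\<rfloor> - 2 * h)\<^sup>2
    \<le> 2 * occurrences (sqrt_grid n) (sqrt (real m))"
proof -
  define S where "S = \<lfloor>sqrt (real n)\<rfloor>"
  let ?X = "sqrt_grid n"
  define P where "P = {(p, q). p \<in> ?X \<and> q \<in> ?X \<and> p \<noteq> q \<and> dist p q = sqrt (real m)}"
  define B where "B = {int h + 1..S - int h} \<times> {int h + 1..S - int h}"
  define F where "F = (\<lambda>((x, y), (u, v)). (int_point (x, y), int_point (x + u, y + v)))"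
  have finP: "finite P"
    by (rule finite_subset[of _ "?X \<times> ?X"]) (auto simp: P_def finite_sqrt_grid)
  have "card (B \<times> square_reps m) \<le> card P"
  proof (rule card_inj_on_le[OF _ _ finP])
    show "inj_on F (B \<times> square_reps m)"
      by (auto simp: inj_on_def F_def int_point_eq_iff)
    show "F ` (B \<times> square_reps m) \<subseteq> P"
    proof
      fix z assume "z \<in> F ` (B \<times> square_reps m)"
      then obtain x y u v where z: "z = F ((x, y), (u, v))" and xy: "(x, y) \<in> B"
        and uv: "(u, v) \<in> square_reps m" by auto
      have "\<bar>u\<bar> \<le> int h" "\<bar>v\<bar> \<le> int h" using square_reps_bound[OF uv assms(2)] by auto
      then have "int_point (x, y) \<in> ?X" "int_point (x + u, y + v) \<in> ?X"
        using xy by (auto simp: sqrt_grid_eq B_def S_def[symmetric] intro!: imageI)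
      moreover have d: "dist (int_point (x, y)) (int_point (x + u, y + v)) = sqrt (real m)"
        using uv by (simp only: dist_int_point) (simp add: square_reps_def)
      moreover have "int_point (x, y) \<noteq> int_point (x + u, y + v)"
        using d assms(1) by (auto simp del: dist_eq_0_iff simp: dist_self)
      ultimately show "z \<in> P" by (simp add: z F_def P_def)
    qed
  qed
  also have "\<dots> \<le> 2 * card ((\<lambda>(p, q). {p, q}) ` P)"
    by (rule card_le_twice_card_unordered_pairs[OF finP])
  also have "(\<lambda>(p, q). {p, q}) ` P
      = {{p, q} | p q. p \<in> ?X \<and> q \<in> ?X \<and> p \<noteq> q \<and> dist p q = sqrt (real m)}"
    by (auto simp: P_def image_iff)
  also have "card \<dots> = occurrences ?X (sqrt (real m))" by (simp add: occurrences_def)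
  also have "card (B \<times> square_reps m) = card (square_reps m) * (nat S - 2 * h)\<^sup>2"
  proof -
    have "nat (S - int h - int h) = nat S - 2 * h" by simp
    then show ?thesis by (simp add: B_def card_cartesian_product power2_eq_square)
  qed
  finally show ?thesis by (simp add: S_def)
qed

text \<open>An infinite set would have \<open>card\<close> 0, so finiteness must be known before the
  number of frequent distances is bounded below. For t > 0 only distances that occur in the grid
  qualify.\<close>

lemma finite_frequent_distances:
  assumes "t > 0"
  shows "finite {d. real (occurrences (sqrt_grid n) d) \<ge> t}"
proof (rule finite_subset)
  let ?X = "sqrt_grid n"
  show "{d. real (occurrences ?X d) \<ge> t} \<subseteq> (\<lambda>(p, q). dist p q) ` (?X \<times> ?X)"
  proof
    fix d assume "d \<in> {d. real (occurrences ?X d) \<ge> t}"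
    then have "occurrences ?X d \<noteq> 0" using assms by auto
    then have "{{p, q} | p q. p \<in> ?X \<and> q \<in> ?X \<and> p \<noteq> q \<and> dist p q = d} \<noteq> {}"
      unfolding occurrences_def by (metis card.empty)
    then show "d \<in> (\<lambda>(p, q). dist p q) ` (?X \<times> ?X)" by auto
  qed
qed (simp add: finite_sqrt_grid)

section \<open>Choice of parameters and asymptotics\<close>

text \<open>Here \<open>L\<close> stands for log n and \<open>w\<close> for c log n / log log n. The
  largest K with q^K \<le> 2^T is the floor of T log 2 / log q; the bound on \<open>w\<close>
  results from T \<ge> L/8 - 1, log 2 \<ge> 1/2 and log q \<le> 2 log L. The 5 pays 1 for the floor,
  1 for the prime 2 and 3 for the factor 8 = 2^3.\<close>

lemma exists_exp_many_square_reps: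
  fixes L w :: real
  assumes L: "L > 8" and w: "0 \<le> w" "w \<le> ((L / 8 - 1) * (1/2) / (2 * ln L) - 5) * (1/2)"
  shows "\<exists>m>0. real m \<le> exp (L / 8) \<and> 8 * exp w \<le> real (card (square_reps m))"
proof -
  define T where "T = nat \<lfloor>L / 8\<rfloor>"
  define q where "q = 4 * T\<^sup>2 + 1"
  define K where "K = nat \<lfloor>real T * ln 2 / ln (real q)\<rfloor>"
  have T: "real T \<le> L / 8" "L / 8 - 1 \<le> real T" "T > 0"
    using L by (simp_all add: T_def) linarith
  have lnL: "ln L > 0" using L by simp
  have q1: "real q > 1" using T(3) by (simp add: q_def)
  have "real q = 4 * (real T)\<^sup>2 + 1" by (simp add: q_def)
  also have "\<dots> \<le> 4 * (L / 8)\<^sup>2 + 1" using T(1) by (simp add: power_mono)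
  also have "\<dots> \<le> L\<^sup>2" using power_mono[of 8 L 2] L by (simp add: power_divide)
  finally have "ln (real q) \<le> ln (L\<^sup>2)" using q1 L by (subst ln_le_cancel_iff) auto
  also have "\<dots> = 2 * ln L" using L by (simp add: ln_realpow)
  finally have lnq: "ln (real q) \<le> 2 * ln L" .
  have lnq0: "ln (real q) > 0" using q1 by simp
  have ln2: "ln 2 \<ge> (1/2 :: real)" using ln2_ge_two_thirds by simp
  have K1: "real K \<le> real T * ln 2 / ln (real q)"
    unfolding K_def using lnq0 by (intro of_nat_floor) simp
  have "real q ^ K = exp (real K * ln (real q))" using q1 by (simp add: exp_of_nat_mult)
  also have "\<dots> \<le> exp (real T * ln 2)" using K1 lnq0 by (simp add: field_simps)
  also have "\<dots> = 2 ^ T" by (simp add: exp_of_nat_mult)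
  finally have "q ^ K \<le> 2 ^ T" by (metis of_nat_le_iff of_nat_numeral of_nat_power)
  then obtain m where m: "m > 0" "m \<le> 2 ^ T" "2 ^ (K - 1) \<le> card (square_reps m)"
    using exists_many_square_reps[OF T(3)] unfolding q_def by blast
  have "real m \<le> 2 ^ T" using m(2) by (metis of_nat_le_iff of_nat_numeral of_nat_power)
  also have "\<dots> = exp (real T * ln 2)" by (simp add: exp_of_nat_mult)
  also have "\<dots> \<le> exp (L / 8)"
    using T(1) mult_left_mono[of "ln 2" 1 "real T"] ln_2_less_1 by simp
  finally have m_le: "real m \<le> exp (L / 8)" .
  have "(L / 8 - 1) * (1/2) / (2 * ln L) \<le> real T * ln 2 / ln (real q)"
    using T(2) ln2 lnq lnq0 L by (intro frac_le mult_mono) auto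
  also have "\<dots> \<le> real K + 1" unfolding K_def by linarith
  finally have K2: "(L / 8 - 1) * (1/2) / (2 * ln L) - 5 \<le> real K - 4" by simp
  \<comment> \<open>Since \<open>w\<close> is nonnegative, K - 4 does not truncate.\<close>
  have "real K \<ge> 4" using K2 w by argo
  then have "K \<ge> 4" by simp
  have "w \<le> (real K - 4) * (1/2)" using w(2) K2 by argo
  also have "\<dots> \<le> (real K - 4) * ln 2"
    using ln2 \<open>K \<ge> 4\<close> by (intro mult_left_mono) auto
  also have "\<dots> = real (K - 4) * ln 2" using \<open>K \<ge> 4\<close> by simp
  finally have "exp w \<le> 2 ^ (K - 4)"
    by (metis exp_le_cancel_iff exp_ln exp_of_nat_mult zero_less_numeral)
  then have "8 * exp w \<le> 2 ^ 3 * 2 ^ (K - 4)" by simp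
  also have "\<dots> = 2 ^ (K - 1)"
  proof -
    have "3 + (K - 4) = K - 1" using \<open>K \<ge> 4\<close> by simp
    then show ?thesis by (simp only: power_add[symmetric])
  qed
  also have "\<dots> \<le> real (card (square_reps m))"
    using m(3) by (metis of_nat_le_iff of_nat_numeral of_nat_power)
  finally show ?thesis using m(1) m_le by blast
qed

theorem theorem1p7:
  shows "\<exists>c::real. c > 0 \<and>
    (\<exists>N::nat. \<forall>n\<ge>N.
      real (card {d::real. d > 0 \<and>
          real (occurrences (sqrt_grid n) d) \<ge> real n powr (1 + c / ln (ln (real n)))})
        \<ge> real n powr (c / ln (ln (real n))))"
proof -
  \<comment> \<open>The last of the four conditions below compares c L / log L with L / (64 log L)
    up to lower-order terms, where L = log n; any c < 1/64 would do.\<close>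
  define c :: real where "c = 1 / 100"
  have "eventually (\<lambda>x::real. x powr (c / ln (ln x)) \<le> x powr (1/16) - 1
      \<and> sqrt x - 1 - 2 * (x powr (1/8) + 1) \<ge> sqrt x / 2 \<and> ln x > 8
      \<and> c * ln x / ln (ln x) \<le> ((ln x / 8 - 1) * (1/2) / (2 * ln (ln x)) - 5) * (1/2)) at_top"
    unfolding c_def by (intro eventually_conj; real_asymp)
  then have "eventually (\<lambda>n. real n powr (c / ln (ln (real n))) \<le> real n powr (1/16) - 1
      \<and> sqrt (real n) - 1 - 2 * (real n powr (1/8) + 1) \<ge> sqrt (real n) / 2 \<and> ln (real n) > 8
      \<and> c * ln (real n) / ln (ln (real n))
        \<le> ((ln (real n) / 8 - 1) * (1/2) / (2 * ln (ln (real n))) - 5) * (1/2)) sequentially"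
    by (rule eventually_compose_filterlim[OF _ filterlim_real_sequentially])
  then obtain N where N: "\<And>n. n \<ge> N \<Longrightarrow>
      real n powr (c / ln (ln (real n))) \<le> real n powr (1/16) - 1
      \<and> sqrt (real n) - 1 - 2 * (real n powr (1/8) + 1) \<ge> sqrt (real n) / 2 \<and> ln (real n) > 8
      \<and> c * ln (real n) / ln (ln (real n))
        \<le> ((ln (real n) / 8 - 1) * (1/2) / (2 * ln (ln (real n))) - 5) * (1/2)"
    unfolding eventually_sequentially by blast
  have "real n powr (c / ln (ln (real n))) \<le> real (card {d. d > 0 \<and>
      real n powr (1 + c / ln (ln (real n))) \<le> real (occurrences (sqrt_grid n) d)})"
    if "n \<ge> N" for n
  proof -
    define x where "x = real n"
    define w where "w = c * ln x / ln (ln x)"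
    \<comment> \<open>With j \<le> n^(1/16) and m \<le> n^(1/8), j^2 m is at most n^(1/4), so all
      displacements fit into a margin h of about n^(1/8).\<close>
    define J where "J = nat \<lfloor>x powr (1/16)\<rfloor>"
    define h where "h = nat \<lceil>x powr (1/8)\<rceil>"
    define S where "S = nat \<lfloor>sqrt x\<rfloor>"
    have x: "x powr (c / ln (ln x)) \<le> x powr (1/16) - 1"
      "sqrt x - 1 - 2 * (x powr (1/8) + 1) \<ge> sqrt x / 2" "ln x > 8"
      "w \<le> ((ln x / 8 - 1) * (1/2) / (2 * ln (ln x)) - 5) * (1/2)"
      using N[OF that] by (simp_all add: x_def w_def)
    have x0: "x > 0" using x(3) by (cases "n = 0") (auto simp: x_def)
    have w0: "w \<ge> 0" using x(3) by (simp add: w_def c_def)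
    have exp_w: "exp w = x powr (c / ln (ln x))" using x0 by (simp add: powr_def w_def)
    obtain m where m: "m > 0" "real m \<le> exp (ln x / 8)" "8 * exp w \<le> real (card (square_reps m))"
      using exists_exp_many_square_reps[OF x(3) w0 x(4)] by blast
    have m_le: "real m \<le> x powr (1/8)" using m(2) x0 by (simp add: powr_def)
    have h: "x powr (1/8) \<le> real h" "real h \<le> x powr (1/8) + 1"
      by (simp_all add: h_def real_nat_ceiling_ge)
    have "sqrt x - 1 \<le> real S" unfolding S_def by linarith
    \<comment> \<open>The central square keeps at least half the side, hence at least
      \<open>x / 4\<close> points.\<close>
    with h(2) x(2) have "sqrt x / 2 \<le> real S - 2 * real h" by argo
    also have "\<dots> \<le> real (S - 2 * h)" by linarith
    finally have "(sqrt x / 2)\<^sup>2 \<le> (real (S - 2 * h))\<^sup>2" using x0 by (intro power_mono) auto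
    then have S: "x / 4 \<le> (real (S - 2 * h))\<^sup>2" using x0 by (simp add: power_divide)
    define D where "D = {d. d > 0 \<and> x powr (1 + c / ln (ln x)) \<le> real (occurrences (sqrt_grid n) d)}"
    have sub: "(\<lambda>j. sqrt (real (j\<^sup>2 * m))) ` {1..J} \<subseteq> D"
    proof
      fix d assume "d \<in> (\<lambda>j. sqrt (real (j\<^sup>2 * m))) ` {1..J}"
      then obtain j where j: "1 \<le> j" "j \<le> J" and d: "d = sqrt (real (j\<^sup>2 * m))" by auto
      have "real J \<le> x powr (1/16)" by (simp add: J_def)
      then have "real j \<le> x powr (1/16)" using j(2) by simp
      then have "real (j\<^sup>2 * m) \<le> (x powr (1/16))\<^sup>2 * x powr (1/8)"
        using m_le by (simp add: mult_mono power_mono)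
      also have "\<dots> = (x powr (1/8))\<^sup>2"
        by (simp add: power2_eq_square flip: powr_add)
      also have "\<dots> \<le> (real h)\<^sup>2" using h(1) by (intro power_mono) auto
      finally have jm: "j\<^sup>2 * m \<le> h\<^sup>2" by (metis of_nat_le_iff of_nat_power)
      \<comment> \<open>This is where the 8 goes: 4 compensates for the quarter of the grid, 2 for
        unordered pairs.\<close>
      have "8 * exp w * (x / 4) \<le> real (card (square_reps (j\<^sup>2 * m))) * (real (S - 2 * h))\<^sup>2"
        using m(3) S x0 card_square_reps_square_mult[of j m] j(1)
        by (intro mult_mono) auto
      also have "\<dots> = real (card (square_reps (j\<^sup>2 * m)) * (S - 2 * h)\<^sup>2)" by simp
      also have "\<dots> \<le> real (2 * occurrences (sqrt_grid n) d)"
        using occurrences_ge[of "j\<^sup>2 * m" h n] jm j(1) m(1) unfolding S_def x_def d of_nat_le_iff by simp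
      finally have "exp w * x \<le> real (occurrences (sqrt_grid n) d)" by (simp add: mult.commute)
      moreover have "exp w * x = x powr (1 + c / ln (ln x))"
        using x0 by (simp add: exp_w powr_add)
      moreover have "d > 0" using j(1) m(1) by (simp add: d)
      ultimately show "d \<in> D" by (simp add: D_def)
    qed
    have "finite {d. x powr (1 + c / ln (ln x)) \<le> real (occurrences (sqrt_grid n) d)}"
      using x0 by (intro finite_frequent_distances) simp
    then have "finite D" by (rule rev_finite_subset) (auto simp: D_def)
    moreover have "inj_on (\<lambda>j. sqrt (real (j\<^sup>2 * m))) {1..J}"
      using m(1) by (auto simp: inj_on_def power2_eq_iff)
    ultimately have "J \<le> card D" using card_mono[OF _ sub] by (simp add: card_image)
    moreover have "x powr (1/16) - 1 \<le> real J" unfolding J_def by linarith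
    ultimately have "x powr (c / ln (ln x)) \<le> real (card D)" using x(1) by linarith
    then show ?thesis by (simp add: D_def x_def)
  qed
  then show ?thesis by (intro exI[of _ c]) (auto simp: c_def)
qed

end
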